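(* For every integer $n\ge1$ there is a bijection $\zeta_2:\mathcal{AD}\mathrm{II}_{n+1}\to\mathcal{RS}\mathrm{II}_n$ such that for every $1\le k\le n$, $\zeta_2$ induces (by restriction) bijections $\mathcal{AD}\mathrm{II}^{(B)}_{n+1,k+1}\to\mathcal{RS}\mathrm{II}^{(B)}_{n,k}$ and $\mathcal{AD}\mathrm{II}^{(D)}_{n+1,-k-1}\to\mathcal{RS}\mathrm{II}^{(D)}_{n,-k}$.
   Context: A signed permutation of $[n]=\{1,\dots,n\}$ is a bijection $\sigma$ of $\{\pm1,\dots,\pm n\}$ onto itself with $\sigma(-i)=-\sigma(i)$, written $\sigma=(\sigma_1,\dots,\sigma_n)$ with $\sigma_i=\sigma(i)$; $B_n$ is the set of these. For $1\le k\le n$, $\sigma_{[k]}$ is the subword of $\sigma$ obtained by removing all entries of absolute value greater than $k$. A double descent of a word of distinct integers is a triple of consecutive letters $a>b>c$; a word ends with an ascent if its last letter is greater than its next-to-last letter (this requirement is vacuous for one-letter words). $\mathcal{RS}\mathrm{II}_n$ is the set of $\sigma\in B_n$ such that $\sigma_{[k]}$ contains no double descent for all $1\le k\le n$. $\mathcal{AD}\mathrm{II}_n$ is the set of $\sigma\in B_n$ containing the entry $1$ (i.e. $\sigma_i=+1$ for some $1\le i\le n$) such that $\sigma_{[k]}$ contains no double descent and ends with an ascent for all $1\le k\le n$. For $1\le k\le n$, the (positive) letter $k$ is an augmenting element of $\sigma$ if $k$ is the last entry of $\sigma_{[k]}$; $\mathrm{gae}(\sigma)$ is the greatest augmenting element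 of $\sigma$ (taken to be $0$ if there is none). $\mathcal{RS}\mathrm{II}^{(B)}_n$ (resp. $\mathcal{AD}\mathrm{II}^{(B)}_n$) is the set of $\sigma\in\mathcal{RS}\mathrm{II}_n$ (resp. $\sigma\in\mathcal{AD}\mathrm{II}_n$) such that $\sigma_i>0$ for every $1\le i\le n$ with $|\sigma_i|=\min\{|\sigma_1|,\dots,|\sigma_i|\}$. $\mathcal{RS}\mathrm{II}^{(D)}_n$ is the set of $\sigma\in\mathcal{RS}\mathrm{II}_n$ such that $\sigma_1<0$, $|\sigma_1|>\mathrm{gae}(\sigma)$, and $\sigma_i>0$ for every $2\le i\le n$ with $|\sigma_i|=\min\{|\sigma_2|,\dots,|\sigma_i|\}$. $\mathcal{AD}\mathrm{II}^{(D)}_n$ is the set of $\sigma\in\mathcal{AD}\mathrm{II}_n$ such that $\sigma_1<0$, $|\sigma_1|>\sigma_n$, and $\sigma_i>0$ for every $2\le i\le n$ with $|\sigma_i|=\min\{|\sigma_2|,\dots,|\sigma_i|\}$. For $1\le k\le n$: $\mathcal{RS}\mathrm{II}^{(B)}_{n,k}=\{\sigma\in\mathcal{RS}\mathrm{II}^{(B)}_n:\mathrm{gae}(\sigma)=k\}$, $\mathcal{RS}\mathrm{II}^{(D)}_{n,-k}=\{\sigma\in\mathcal{RS}\mathrm{II}^{(D)}_n:\sigma_1=-k\}$. For $2\le k\le n$: $\mathcal{AD}\mathrm{II}^{(B)}_{n,k}=\{\sigma\in\mathcal{AD}\mathrm{II}^{(B)}_n:\sigma_n=k\}$, $\mathcal{AD}\mathrm{II}^{(D)}_{n,-k}=\{\sigma\in\mathcal{AD}\mathrm{II}^{(D)}_n:\sigma_1=-k\}$.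 *)

theory Defs
  imports Main "HOL-Combinatorics.Permutations"
begin

definition pm_interval :: "nat \<Rightarrow> int set" where
  "pm_interval n = {i. 1 \<le> \<bar>i\<bar> \<and> \<bar>i\<bar> \<le> int n}"

text \<open>A signed permutation is a bijection of \<open>pm_interval n\<close>; as a total function on the integers
  it is extended by the identity (built into \<open>permutes\<close>), so that distinct elements of
  \<open>signed_perms n\<close> are distinct signed permutations.\<close>

definition signed_perms :: "nat \<Rightarrow> (int \<Rightarrow> int) set" where
  "signed_perms n = {\<sigma>. \<sigma> permutes pm_interval n \<and> (\<forall>i\<in>pm_interval n. \<sigma> (- i) = - \<sigma> i)}"

definition word :: "nat \<Rightarrow> (int \<Rightarrow> int) \<Rightarrow> int list" where
  "word n \<sigma> = map \<sigma> [1..int n]"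

definition subword :: "nat \<Rightarrow> (int \<Rightarrow> int) \<Rightarrow> int \<Rightarrow> int list" where
  "subword n \<sigma> k = filter (\<lambda>x. \<bar>x\<bar> \<le> k) (word n \<sigma>)"

definition has_double_descent :: "int list \<Rightarrow> bool" where
  "has_double_descent w \<longleftrightarrow>
     (\<exists>i. i + 2 < length w \<and> w ! i > w ! (i + 1) \<and> w ! (i + 1) > w ! (i + 2))"

definition ends_with_ascent :: "int list \<Rightarrow> bool" where
  "ends_with_ascent w \<longleftrightarrow> (2 \<le> length w \<longrightarrow> w ! (length w - 2) < w ! (length w - 1))"

definition RSII :: "nat \<Rightarrow> (int \<Rightarrow> int) set" where
  "RSII n = {\<sigma> \<in> signed_perms n. \<forall>k\<in>{1..int n}. \<not> has_double_descent (subword n \<sigma> k)}"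

definition ADII :: "nat \<Rightarrow> (int \<Rightarrow> int) set" where
  "ADII n = {\<sigma> \<in> signed_perms n. (\<exists>i\<in>{1..int n}. \<sigma> i = 1) \<and>
     (\<forall>k\<in>{1..int n}. \<not> has_double_descent (subword n \<sigma> k) \<and> ends_with_ascent (subword n \<sigma> k))}"

definition augmenting :: "nat \<Rightarrow> (int \<Rightarrow> int) \<Rightarrow> int \<Rightarrow> bool" where
  "augmenting n \<sigma> k \<longleftrightarrow> 1 \<le> k \<and> k \<le> int n \<and> last (subword n \<sigma> k) = k"

definition gae :: "nat \<Rightarrow> (int \<Rightarrow> int) \<Rightarrow> int" where
  "gae n \<sigma> = Max (insert 0 {k. augmenting n \<sigma> k})"

text \<open>The entries of \<open>\<sigma>\<close> at positions \<open>m, \<dots>, n\<close> that are left-to-right minima in absolute value,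
  counting from position \<open>m\<close>, are positive; \<open>m = 1\<close> and \<open>m = 2\<close> are the conditions of types B and D.\<close>

definition positive_abs_minima :: "nat \<Rightarrow> int \<Rightarrow> (int \<Rightarrow> int) \<Rightarrow> bool" where
  "positive_abs_minima n m \<sigma> \<longleftrightarrow>
     (\<forall>i\<in>{m..int n}. \<bar>\<sigma> i\<bar> = Min ((\<lambda>j. \<bar>\<sigma> j\<bar>) ` {m..i}) \<longrightarrow> \<sigma> i > 0)"

definition RSII_B :: "nat \<Rightarrow> (int \<Rightarrow> int) set" where
  "RSII_B n = {\<sigma> \<in> RSII n. positive_abs_minima n 1 \<sigma>}"

definition ADII_B :: "nat \<Rightarrow> (int \<Rightarrow> int) set" where
  "ADII_B n = {\<sigma> \<in> ADII n. positive_abs_minima n 1 \<sigma>}"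

definition RSII_D :: "nat \<Rightarrow> (int \<Rightarrow> int) set" where
  "RSII_D n = {\<sigma> \<in> RSII n. \<sigma> 1 < 0 \<and> \<bar>\<sigma> 1\<bar> > gae n \<sigma> \<and> positive_abs_minima n 2 \<sigma>}"

definition ADII_D :: "nat \<Rightarrow> (int \<Rightarrow> int) set" where
  "ADII_D n = {\<sigma> \<in> ADII n. \<sigma> 1 < 0 \<and> \<bar>\<sigma> 1\<bar> > \<sigma> (int n) \<and> positive_abs_minima n 2 \<sigma>}"

definition RSII_B_at :: "nat \<Rightarrow> int \<Rightarrow> (int \<Rightarrow> int) set" where
  "RSII_B_at n k = {\<sigma> \<in> RSII_B n. gae n \<sigma> = k}"

definition ADII_B_at :: "nat \<Rightarrow> int \<Rightarrow> (int \<Rightarrow> int) set" where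
  "ADII_B_at n k = {\<sigma> \<in> ADII_B n. \<sigma> (int n) = k}"

text \<open>The type D families are indexed by the (negative) first letter itself.\<close>

definition RSII_D_at :: "nat \<Rightarrow> int \<Rightarrow> (int \<Rightarrow> int) set" where
  "RSII_D_at n l = {\<sigma> \<in> RSII_D n. \<sigma> 1 = l}"

definition ADII_D_at :: "nat \<Rightarrow> int \<Rightarrow> (int \<Rightarrow> int) set" where
  "ADII_D_at n l = {\<sigma> \<in> ADII_D n. \<sigma> 1 = l}"

end

theory Submission
  imports Defs
begin

text \<open>
  Write signed permutations as words and build them by inserting the letters \<open>\<plusminus>1, \<plusminus>2, \<dots>\<close> in order
  of absolute value. The letter just inserted dominates all others in absolute value, so its sign
  and position alone decide how the descents change. The words over \<open>\<plusminus>1, \<dots>, \<plusminus>(n + 1)\<close> that contain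
  \<open>1\<close> and whose restrictions all end with an ascent grow from the word \<open>1\<close>. When such a word has
  length \<open>m + 1\<close>, the letter \<open>m + 2\<close> may go to every position except the last but one, and
  \<open>-(m + 2)\<close> to every position except the last: any other choice would spoil the final ascent.
  An arbitrary signed word of length \<open>m\<close> has exactly as many extensions by \<open>\<plusminus>(m + 1)\<close>. Pair the
  insertions at the same position with the same sign, and pair appending \<open>m + 2\<close> to the first word
  with appending \<open>m + 1\<close> to the second. Iterating gives a bijection, the relation \<open>twin\<close>, from
  the words just described to all signed words of length \<open>n\<close>. For instance \<open>1 -3 2\<close> corresponds
  to \<open>1 -2\<close>, and \<open>3 1 2\<close> to \<open>2 1\<close>.

  If \<open>W\<close> and \<open>R\<close> are twins, then \<open>R\<close> has the descents of \<open>W\<close>; the one additional step of \<open>W\<close>, into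
  its last letter, is an ascent (\<open>twin_descents\<close>, \<open>twin_ends_with_ascent\<close>). Hence \<open>W\<close> and \<open>R\<close> have
  double descents simultaneously, and since restrictions of twins are twins (\<open>twin_below\<close>), the
  bijection matches \<open>ADII (n + 1)\<close> with \<open>RSII n\<close>. The finer statements follow because the greatest
  augmenting letter of \<open>R\<close> is the last letter of \<open>W\<close> minus one (\<open>twin_last\<close>), a negative letter
  \<open>-k\<close> of \<open>R\<close> stands where \<open>W\<close> has \<open>-k - 1\<close> (\<open>twin_negative_letters\<close>), and the letters of smaller
  absolute value to the left of a negative letter occupy the same places in both words
  (\<open>twin_abs_less\<close>), so that the sign conditions on left-to-right minima agree as well.
\<close>

section \<open>Signed words and insertion of the largest letter\<close>

abbreviation below :: "int \<Rightarrow> int list \<Rightarrow> int list" where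
  "below k w \<equiv> filter (\<lambda>x. \<bar>x\<bar> \<le> k) w"

definition signed_words :: "nat \<Rightarrow> int list set" where
  "signed_words n = {w. length w = n \<and> abs ` set w = {1..int n}}"

definition insert_at :: "nat \<Rightarrow> int \<Rightarrow> int list \<Rightarrow> int list" where
  "insert_at p x w = take p w @ x # drop p w"

lemma set_insert_at: "set (insert_at p x w) = insert x (set w)"
proof -
  have "set w = set (take p w) \<union> set (drop p w)"
    by (metis append_take_drop_id set_append)
  then show ?thesis by (simp add: insert_at_def)
qed

lemma length_insert_at [simp]: "length (insert_at p x w) = Suc (length w)"
  by (simp add: insert_at_def)

lemma nth_insert_at:
  assumes "p \<le> length w" "i \<le> length w"
  shows "insert_at p x w ! i = (if i < p then w ! i else if i = p then x else w ! (i - 1))"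
  using assms by (auto simp: insert_at_def nth_append nth_Cons' min_def)

lemma below_insert_at: "k < \<bar>x\<bar> \<Longrightarrow> below k (insert_at p x w) = below k w"
proof -
  assume "k < \<bar>x\<bar>"
  then have "below k (insert_at p x w) = below k (take p w) @ below k (drop p w)"
    by (simp add: insert_at_def)
  also have "\<dots> = below k w" by (metis append_take_drop_id filter_append)
  finally show ?thesis .
qed

lemma signed_word_length: "w \<in> signed_words n \<Longrightarrow> length w = n"
  by (simp add: signed_words_def)

lemma signed_word_bound: "w \<in> signed_words n \<Longrightarrow> y \<in> set w \<Longrightarrow> 1 \<le> \<bar>y\<bar> \<and> \<bar>y\<bar> \<le> int n"
  by (auto simp: signed_words_def)

lemma below_signed_word: "w \<in> signed_words n \<Longrightarrow> int n \<le> k \<Longrightarrow> below k w = w"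
  using signed_word_bound by (fastforce intro: filter_True)

lemma signed_word_distinct: "w \<in> signed_words n \<Longrightarrow> distinct (map abs w)"
  by (rule card_distinct) (simp add: signed_words_def)

lemma insert_at_signed_words:
  assumes "w \<in> signed_words n" "\<bar>x\<bar> = int n + 1"
  shows "insert_at p x w \<in> signed_words (Suc n)"
  using assms by (auto simp: signed_words_def set_insert_at)

lemma append_signed_words:
  "w \<in> signed_words n \<Longrightarrow> w @ [int n + 1] \<in> signed_words (Suc n)"
  by (auto simp: signed_words_def)

lemma signed_words_Suc_cases:
  assumes "w \<in> signed_words (Suc n)"
  obtains p x w' where "w = insert_at p x w'" "p \<le> n" "\<bar>x\<bar> = int n + 1" "w' \<in> signed_words n"
proof -
  have im: "abs ` set w = {1..int n + 1}" and len: "length w = Suc n"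
    using assms by (auto simp: signed_words_def)
  then obtain x where x: "x \<in> set w" "\<bar>x\<bar> = int n + 1"
    by (metis atLeastAtMost_iff imageE le_add_same_cancel2 of_nat_0_le_iff order_refl)
  then obtain u v where w: "w = u @ x # v" by (meson split_list)
  have d: "\<bar>x\<bar> \<notin> abs ` set (u @ v)"
    using signed_word_distinct[OF assms] by (auto simp: w)
  have "abs ` set w = insert \<bar>x\<bar> (abs ` set (u @ v))" by (auto simp: w)
  then have "abs ` set (u @ v) = {1..int n + 1} - {int n + 1}"
    using Diff_insert_absorb[OF d] unfolding im x(2) by simp
  also have "\<dots> = {1..int n}" by auto
  finally have "u @ v \<in> signed_words n" using len by (simp add: signed_words_def w)
  moreover have "w = insert_at (length u) x (u @ v)" "length u \<le> n"
    using len by (auto simp: w insert_at_def)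
  ultimately show ?thesis using that x by blast
qed

lemma insert_at_inject:
  assumes "insert_at p x w = insert_at q y w'"
    and "w \<in> signed_words n" "w' \<in> signed_words n" "p \<le> n" "q \<le> n"
    and "\<bar>x\<bar> = int n + 1" "\<bar>y\<bar> = int n + 1"
  shows "p = q \<and> x = y \<and> w = w'"
proof -
  have nx: "z \<notin> set w" "z \<notin> set w'" if "\<bar>z\<bar> = int n + 1" for z
    using that assms signed_word_bound by fastforce+
  have "insert x (set w) = insert y (set w')"
    using assms(1) by (metis set_insert_at)
  then have xy: "x = y" using nx assms by blast
  have "take p w = take q w' \<and> drop p w = drop q w'"
    using assms(1) nx[OF assms(6)] unfolding insert_at_def xy
    by (subst (asm) append_Cons_eq_iff) (auto dest: in_set_takeD in_set_dropD)
  moreover have "length (take p w) = p" "length (take q w') = q"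
    using assms signed_word_length by auto
  ultimately show ?thesis using xy by (metis append_take_drop_id)
qed

text \<open>A letter of dominating absolute value compares with its neighbours through its sign alone: a
  positive one makes an ascent followed by a descent, a negative one the reverse.\<close>

lemma descent_insert_at:
  assumes "p \<le> length w" "i < length w" "\<And>y. y \<in> set w \<Longrightarrow> \<bar>y\<bar> < \<bar>x\<bar>"
  shows "insert_at p x w ! i > insert_at p x w ! Suc i \<longleftrightarrow>
    (if Suc i < p then w ! i > w ! Suc i else if Suc i = p then x < 0
     else if i = p then x > 0 else w ! (i - 1) > w ! i)"
proof -
  have "\<bar>w ! i\<bar> < \<bar>x\<bar>" using assms by simp
  then show ?thesis using assms(1,2) by (auto simp: nth_insert_at)
qed

section \<open>Twin words\<close>

text \<open>The condition \<open>p < n \<or> x < 0\<close> leaves out the insertion of a positive letter at position \<open>n\<close>: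
  for the right word this is the rule \<open>augment\<close>; for the left word, of length \<open>n + 1\<close>, it would
  create a final descent. The term \<open>x + sgn x\<close> is \<open>x\<close> moved
  away from zero by one.\<close>

inductive twin :: "nat \<Rightarrow> int list \<Rightarrow> int list \<Rightarrow> bool" where
  start: "twin 0 [1] []"
| augment: "twin n W R \<Longrightarrow> twin (Suc n) (W @ [int n + 2]) (R @ [int n + 1])"
| insertion: "twin n W R \<Longrightarrow> p \<le> n \<Longrightarrow> \<bar>x\<bar> = int n + 1 \<Longrightarrow> p < n \<or> x < 0 \<Longrightarrow>
    twin (Suc n) (insert_at p (x + sgn x) W) (insert_at p x R)"

lemma abs_shift: "\<bar>x\<bar> = int n + 1 \<Longrightarrow> \<bar>x + sgn x\<bar> = int n + 2"
  by (cases "x > 0") auto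

lemma twin_signed_words:
  "twin n W R \<Longrightarrow> W \<in> signed_words (Suc n) \<and> R \<in> signed_words n"
proof (induction rule: twin.induct)
  case start
  show ?case by (auto simp: signed_words_def)
next
  case (augment n W R)
  then show ?case
    using append_signed_words[of W "Suc n"] append_signed_words[of R n] by (simp add: add.commute)
next
  case (insertion n W R p x)
  then show ?case
    using insert_at_signed_words[of W "Suc n" "x + sgn x" p] insert_at_signed_words[of R n x p]
      abs_shift[of x n] by simp
qed

lemma twin_below_full:
  assumes "twin n W R"
  shows "below (int n + 1) W = W" "below (int n) R = R"
  using twin_signed_words[OF assms] below_signed_word[of W "Suc n"] below_signed_word[of R n]
  by auto

text \<open>Restricting a word to its small letters undoes the last insertions.\<close>

lemma twin_below:
  "twin n W R \<Longrightarrow> k \<le> n \<Longrightarrow> twin k (below (int k + 1) W) (below (int k) R)"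
proof (induction rule: twin.induct)
  case start
  then show ?case by (simp add: twin.start)
next
  case (augment n W R)
  show ?case
  proof (cases "k = Suc n")
    case True
    have t: "twin (Suc n) (W @ [int n + 2]) (R @ [int n + 1])" using augment.hyps by (rule twin.augment)
    show ?thesis unfolding True twin_below_full[OF t] by (rule t)
  next
    case False
    then show ?thesis using augment by simp
  qed
next
  case (insertion n W R p x)
  show ?case
  proof (cases "k = Suc n")
    case True
    have t: "twin (Suc n) (insert_at p (x + sgn x) W) (insert_at p x R)"
      using insertion.hyps by (intro twin.insertion)
    show ?thesis unfolding True twin_below_full[OF t] by (rule t)
  next
    case False
    then show ?thesis using insertion abs_shift[of x n] by (simp add: below_insert_at)
  qed
qed

lemma twin_last_positive: "twin n W R \<Longrightarrow> last W > 0"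
proof (induction rule: twin.induct)
  case (insertion n W R p x)
  then have "length W = Suc n" using twin_signed_words signed_word_length by blast
  then show ?case using insertion by (simp add: insert_at_def last_drop)
qed auto

text \<open>A letter put immediately before the last one is negative, while the last letter is positive.\<close>

lemma twin_ends_with_ascent: "twin n W R \<Longrightarrow> ends_with_ascent W"
proof (induction rule: twin.induct)
  case start
  show ?case by (simp add: ends_with_ascent_def)
next
  case (augment n W R)
  have W: "W \<in> signed_words (Suc n)" using augment twin_signed_words by blast
  then have "length W = Suc n" by (rule signed_word_length)
  moreover have "W ! n < int n + 2"
    using signed_word_bound[OF W, of "W ! n"] calculation nth_mem[of n W] by linarith
  ultimately show ?case by (simp add: ends_with_ascent_def nth_append)
next
  case (insertion n W R p x)
  have W: "W \<in> signed_words (Suc n)" using insertion twin_signed_words by blast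
  then have len: "length W = Suc n" by (rule signed_word_length)
  then have "W ! n > 0" using twin_last_positive[OF insertion.hyps(1)] 
    by (metis diff_Suc_1 last_conv_nth length_0_conv nat.simps(3))
  then show ?case using insertion len by (auto simp: ends_with_ascent_def nth_insert_at sgn_if)
qed

text \<open>Paired letters have the same sign and, in the rule \<open>insertion\<close>, the same position, so they
  change the descents in the same way. In the rule \<open>augment\<close> the right word gains an ascent at its
  end; the left word shows an ascent at that place because it ended with one before.\<close>

lemma twin_descents:
  "twin n W R \<Longrightarrow> Suc i < n \<Longrightarrow> W ! i > W ! Suc i \<longleftrightarrow> R ! i > R ! Suc i"
proof (induction arbitrary: i rule: twin.induct)
  case start
  then show ?case by simp
next
  case (augment n W R)
  have WR: "W \<in> signed_words (Suc n)" "R \<in> signed_words n"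
    using augment twin_signed_words by blast+
  then have len: "length W = Suc n" "length R = n" using signed_word_length by blast+
  show ?case
  proof (cases "Suc i < n")
    case True
    then show ?thesis using augment len by (simp add: nth_append)
  next
    case False
    then have n: "n = Suc i" using augment by simp
    have "R ! i < int n + 1" using signed_word_bound[OF WR(2), of "R ! i"] len n nth_mem[of i R] by linarith
    moreover have "W ! i < W ! Suc i"
      using twin_ends_with_ascent[OF augment.hyps(1)] len n by (simp add: ends_with_ascent_def)
    ultimately show ?thesis using len n by (simp add: nth_append)
  qed
next
  case (insertion n W R p x)
  have WR: "W \<in> signed_words (Suc n)" "R \<in> signed_words n"
    using insertion twin_signed_words by blast+
  then have len: "length W = Suc n" "length R = n" using signed_word_length by blast+
  have "insert_at p (x + sgn x) W ! i > insert_at p (x + sgn x) W ! Suc i \<longleftrightarrow>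
    (if Suc i < p then W ! i > W ! Suc i else if Suc i = p then x + sgn x < 0
     else if i = p then x + sgn x > 0 else W ! (i - 1) > W ! i)"
    using insertion len abs_shift[of x n] signed_word_bound[OF WR(1)]
    by (intro descent_insert_at) force+
  moreover have "insert_at p x R ! i > insert_at p x R ! Suc i \<longleftrightarrow>
    (if Suc i < p then R ! i > R ! Suc i else if Suc i = p then x < 0
     else if i = p then x > 0 else R ! (i - 1) > R ! i)"
    using insertion len signed_word_bound[OF WR(2)]
    by (intro descent_insert_at) force+
  moreover have "x + sgn x < 0 \<longleftrightarrow> x < 0" "x + sgn x > 0 \<longleftrightarrow> x > 0" by (auto simp: sgn_if)
  ultimately show ?case using insertion.IH[of i] insertion.IH[of "i - 1"] insertion.prems insertion.hyps(2)
    by auto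
qed

text \<open>The extra last step of the left word is an ascent and cannot take part in a double descent.\<close>

lemma twin_double_descent:
  assumes "twin n W R"
  shows "has_double_descent W \<longleftrightarrow> has_double_descent R"
proof -
  have len: "length W = Suc n" "length R = n"
    using assms twin_signed_words signed_word_length by blast+
  have asc: "W ! i < W ! Suc i" if "Suc i = n" for i
    using twin_ends_with_ascent[OF assms] len unfolding ends_with_ascent_def that[symmetric]
    by simp
  show ?thesis
  proof
    assume "has_double_descent W"
    then obtain i where i: "i + 2 < Suc n" "W ! i > W ! Suc i" "W ! Suc i > W ! Suc (Suc i)"
      by (auto simp: has_double_descent_def len)
    then have "i + 2 < n" using asc[of "Suc i"] by (cases "i + 2 = n") auto
    then show "has_double_descent R"
      using i twin_descents[OF assms, of i] twin_descents[OF assms, of "Suc i"] len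
      by (auto simp: has_double_descent_def intro!: exI[of _ i])
  next
    assume "has_double_descent R"
    then obtain i where i: "i + 2 < n" "R ! i > R ! Suc i" "R ! Suc i > R ! Suc (Suc i)"
      by (auto simp: has_double_descent_def len)
    then show "has_double_descent W"
      using twin_descents[OF assms, of i] twin_descents[OF assms, of "Suc i"] len
      by (auto simp: has_double_descent_def intro!: exI[of _ i])
  qed
qed

lemma twin_negative_letters:
  "twin n W R \<Longrightarrow> i < n \<Longrightarrow>
    (W ! i < 0 \<longleftrightarrow> R ! i < 0) \<and> (R ! i < 0 \<longrightarrow> W ! i = R ! i - 1)"
proof (induction arbitrary: i rule: twin.induct)
  case start
  then show ?case by simp
next
  case (augment n W R)
  have len: "length W = Suc n" "length R = n"
    using augment twin_signed_words signed_word_length by blast+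
  have "W ! n > 0" using twin_last_positive[OF augment.hyps] len
    by (metis diff_Suc_1 last_conv_nth length_0_conv nat.simps(3))
  then show ?case using augment len by (auto simp: nth_append less_Suc_eq)
next
  case (insertion n W R p x)
  have len: "length W = Suc n" "length R = n"
    using insertion twin_signed_words signed_word_length by blast+
  show ?case using insertion.prems insertion.hyps len insertion.IH[of i] insertion.IH[of "i - 1"]
    by (auto simp: nth_insert_at sgn_if)
qed

text \<open>A negative letter enters both words at the same moment: it then exceeds in absolute value
  everything already present, and everything inserted later exceeds it. For positive letters this
  fails, since \<open>augment\<close> aligns the new letter of the right word with an older letter of the left
  word: the third letter is larger than the first in \<open>2 1 3\<close>, but not in its twin \<open>3 1 2 4\<close>.\<close>

lemma twin_abs_less:
  "twin n W R \<Longrightarrow> j < i \<Longrightarrow> i < n \<Longrightarrow> R ! i < 0 \<Longrightarrow>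
    \<bar>W ! j\<bar> < \<bar>W ! i\<bar> \<longleftrightarrow> \<bar>R ! j\<bar> < \<bar>R ! i\<bar>"
proof (induction arbitrary: i j rule: twin.induct)
  case start
  then show ?case by simp
next
  case (augment n W R)
  have len: "length W = Suc n" "length R = n"
    using augment twin_signed_words signed_word_length by blast+
  then show ?case using augment by (auto simp: nth_append less_Suc_eq)
next
  case (insertion n W R p x)
  have WR: "W \<in> signed_words (Suc n)" "R \<in> signed_words n"
    using insertion twin_signed_words by blast+
  then have len: "length W = Suc n" "length R = n" using signed_word_length by blast+
  have bW: "\<bar>W ! l\<bar> < \<bar>x + sgn x\<bar>" if "l \<le> n" for l
    using signed_word_bound[OF WR(1), of "W ! l"] that len abs_shift[of x n] insertion.hyps by simp
  have bR: "\<bar>R ! l\<bar> < \<bar>x\<bar>" if "l < n" for l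
    using signed_word_bound[OF WR(2), of "R ! l"] that len insertion.hyps by simp
  consider "i < p" | "i = p" | "p < i" "j < p" | "p < i" "j = p" | "p < i" "p < j" by linarith
  then show ?case
  proof cases
    case 1
    then show ?thesis using insertion len by (simp add: nth_insert_at)
  next
    case 2
    then show ?thesis using insertion.prems insertion.hyps len bW[of j] bR[of j]
      by (simp add: nth_insert_at)
  next
    case 3
    then show ?thesis using insertion.prems insertion.hyps len insertion.IH[of j "i - 1"]
      by (simp add: nth_insert_at)
  next
    case 4
    then have "\<not> \<bar>x + sgn x\<bar> < \<bar>W ! (i - 1)\<bar>" "\<not> \<bar>x\<bar> < \<bar>R ! (i - 1)\<bar>"
      using insertion.prems bW[of "i - 1"] bR[of "i - 1"] by linarith+
    with 4 show ?thesis using insertion.prems insertion.hyps len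
      by (simp add: nth_insert_at)
  next
    case 5
    then show ?thesis using insertion.prems insertion.hyps len insertion.IH[of "j - 1" "i - 1"]
      by (simp add: nth_insert_at)
  qed
qed

text \<open>The negative letters from index \<open>s\<close> on are no left-to-right minima in absolute value, counting
  from \<open>s\<close>. This is the condition \<open>positive_abs_minima\<close> phrased for words, with positions counted
  from \<open>0\<close>.\<close>

definition guarded :: "nat \<Rightarrow> int list \<Rightarrow> bool" where
  "guarded s w \<longleftrightarrow>
     (\<forall>i<length w. s \<le> i \<and> w ! i < 0 \<longrightarrow> (\<exists>j. s \<le> j \<and> j < i \<and> \<bar>w ! j\<bar> < \<bar>w ! i\<bar>))"

lemma twin_guarded:
  assumes "twin n W R"
  shows "guarded s W \<longleftrightarrow> guarded s R"
proof -
  have len: "length W = Suc n" "length R = n"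
    using assms twin_signed_words signed_word_length by blast+
  have "W ! n > 0" using twin_last_positive[OF assms] len
    by (metis diff_Suc_1 last_conv_nth length_0_conv nat.simps(3))
  then have "guarded s W \<longleftrightarrow>
      (\<forall>i<n. s \<le> i \<and> W ! i < 0 \<longrightarrow> (\<exists>j. s \<le> j \<and> j < i \<and> \<bar>W ! j\<bar> < \<bar>W ! i\<bar>))"
    by (auto simp: guarded_def len less_Suc_eq)
  also have "\<dots> \<longleftrightarrow> guarded s R"
    using twin_negative_letters[OF assms] twin_abs_less[OF assms]
    unfolding guarded_def len by (metis (no_types, lifting))
  finally show ?thesis .
qed

definition augmenting_letters :: "nat \<Rightarrow> int list \<Rightarrow> int set" where
  "augmenting_letters n w = {k. 1 \<le> k \<and> k \<le> int n \<and> last (below k w) = k}"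

lemma finite_augmenting_letters: "finite (augmenting_letters n w)"
  by (rule finite_subset[of _ "{1..int n}"]) (auto simp: augmenting_letters_def)

text \<open>Both sides change only under the rule \<open>augment\<close>, where the new letter becomes the last letter
  of the left word and the greatest augmenting letter of the right word. With no augmenting letter,
  the last letter of the left word is still the initial \<open>1\<close>, matching the value \<open>0\<close>.\<close>

lemma twin_last: "twin n W R \<Longrightarrow> last W = Max (insert 0 (augmenting_letters n R)) + 1"
proof (induction rule: twin.induct)
  case start
  have "augmenting_letters 0 [] = {}" by (auto simp: augmenting_letters_def)
  then show ?case by simp
next
  case (augment n W R)
  let ?A = "augmenting_letters (Suc n) (R @ [int n + 1])"
  have "Max (insert 0 ?A) = int n + 1"
    by (rule Max_eqI) (auto simp: finite_augmenting_letters, auto simp: augmenting_letters_def)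
  then show ?case by simp
next
  case (insertion n W R p x)
  have R: "R \<in> signed_words n" and W: "W \<in> signed_words (Suc n)"
    using insertion twin_signed_words by blast+
  then have len: "length R = n" "length W = Suc n" using signed_word_length by blast+
  let ?R = "insert_at p x R"
  have R': "?R \<in> signed_words (Suc n)"
    using R insertion by (intro insert_at_signed_words)
  have "last ?R \<noteq> int n + 1"
  proof (cases "p < n")
    case True
    then have "last ?R = last R" "R \<noteq> []" using len by (auto simp: insert_at_def last_drop)
    then show ?thesis using signed_word_bound[OF R, of "last R"] by auto
  next
    case False
    then show ?thesis using insertion len by (simp add: insert_at_def)
  qed
  then have "last (below k ?R) = k \<longleftrightarrow> k \<le> int n \<and> last (below k R) = k"
    if "k \<le> int n + 1" for k
    using that insertion.hyps below_signed_word[OF R', of "int n + 1"] below_insert_at[of k x p R]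
    by (cases "k = int n + 1") auto
  then have "augmenting_letters (Suc n) ?R = augmenting_letters n R"
    unfolding augmenting_letters_def by fastforce
  moreover have "last (insert_at p (x + sgn x) W) = last W"
    using insertion.hyps len by (simp add: insert_at_def last_drop)
  ultimately show ?case using insertion.IH by simp
qed

section \<open>Twins are unique, and every admissible word has one\<close>

lemma append_eq_insert_at: "length w = n \<Longrightarrow> w @ [x] = insert_at n x w"
  by (simp add: insert_at_def)

text \<open>The largest letter of a word and its position show which rule was applied last and to what.\<close>

lemma twin_unique_right: "twin n W R \<Longrightarrow> twin n W R' \<Longrightarrow> R = R'"
proof (induction arbitrary: R' rule: twin.induct)
  case start
  then show ?case by (cases rule: twin.cases) auto
next
  case (augment n W R)
  have W: "W \<in> signed_words (Suc n)" using augment twin_signed_words by blast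
  have l: "length W = Suc n" using W signed_word_length by blast
  from augment.prems show ?case
  proof (cases rule: twin.cases)
    case (augment R2)
    then show ?thesis using augment.IH by auto
  next
    case (insertion W2 R2 p x)
    then have "W2 \<in> signed_words (Suc n)" using twin_signed_words by blast
    moreover have "insert_at (Suc n) (int n + 2) W = insert_at p (x + sgn x) W2"
      using insertion append_eq_insert_at[OF l] by simp
    ultimately have "Suc n = p"
      using insert_at_inject[OF _ W, of "Suc n" "int n + 2" p "x + sgn x" W2] insertion abs_shift[of x n]
      by simp
    then show ?thesis using insertion by simp
  qed
next
  case (insertion n W R p x)
  have W: "W \<in> signed_words (Suc n)" using insertion twin_signed_words by blast
  have l: "length W = Suc n" using W signed_word_length by blast
  show ?case using insertion.prems
  proof (cases rule: twin.cases)
    case (augment W2 R2)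
    then have "W2 \<in> signed_words (Suc n)" using twin_signed_words by blast
    then have "p = Suc n"
      using insert_at_inject[OF _ W, of p "x + sgn x" "Suc n" "int n + 2" W2] augment abs_shift[of x n]
        insertion.hyps append_eq_insert_at[of W2 "Suc n"] signed_word_length by simp
    then show ?thesis using insertion.hyps by simp
  next
    case (insertion W2 R2 q y)
    then have "W2 \<in> signed_words (Suc n)" using twin_signed_words by blast
    then have "p = q \<and> x + sgn x = y + sgn y \<and> W = W2"
      using insert_at_inject[OF _ W, of p "x + sgn x" q "y + sgn y" W2] insertion abs_shift[of x n]
        abs_shift[of y n] \<open>p \<le> n\<close> \<open>\<bar>x\<bar> = int n + 1\<close> by simp
    moreover from this have "x = y" by (auto simp: sgn_if split: if_splits)
    ultimately show ?thesis using insertion insertion.IH by auto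
  qed
qed

lemma twin_unique_left: "twin n W R \<Longrightarrow> twin n W' R \<Longrightarrow> W = W'"
proof (induction arbitrary: W' rule: twin.induct)
  case start
  then show ?case by (cases rule: twin.cases) auto
next
  case (augment n W R)
  have R: "R \<in> signed_words n" using augment twin_signed_words by blast
  have l: "length R = n" using R signed_word_length by blast
  from augment.prems show ?case
  proof (cases rule: twin.cases)
    case (augment W2)
    then show ?thesis using augment.IH by auto
  next
    case (insertion W2 R2 p x)
    then have "R2 \<in> signed_words n" using twin_signed_words by blast
    then have "n = p \<and> int n + 1 = x"
      using insert_at_inject[OF _ R, of n "int n + 1" p x R2] insertion append_eq_insert_at[OF l]
      by simp
    then show ?thesis using insertion by simp
  qed
next
  case (insertion n W R p x)
  have R: "R \<in> signed_words n" using insertion twin_signed_words by blast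
  show ?case using insertion.prems
  proof (cases rule: twin.cases)
    case (augment W2 R2)
    then have "R2 \<in> signed_words n" using twin_signed_words by blast
    then have "p = n \<and> x = int n + 1"
      using insert_at_inject[OF _ R, of p x n "int n + 1" R2] augment
        insertion.hyps append_eq_insert_at[of R2 n] signed_word_length by simp
    then show ?thesis using insertion.hyps by simp
  next
    case (insertion W2 R2 q y)
    then have "R2 \<in> signed_words n" using twin_signed_words by blast
    then have "p = q \<and> x = y \<and> R = R2"
      using insert_at_inject[OF _ R, of p x q y R2] insertion \<open>p \<le> n\<close> \<open>\<bar>x\<bar> = int n + 1\<close> by simp
    then show ?thesis using insertion insertion.IH by auto
  qed
qed

lemma twin_exists_left: "R \<in> signed_words n \<Longrightarrow> \<exists>W. twin n W R"
proof (induction n arbitrary: R)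
  case 0
  then show ?case using twin.start by (auto simp: signed_words_def)
next
  case (Suc n)
  obtain p x R' where R: "R = insert_at p x R'" "p \<le> n" "\<bar>x\<bar> = int n + 1" "R' \<in> signed_words n"
    using Suc.prems by (rule signed_words_Suc_cases)
  then obtain W where W: "twin n W R'" using Suc.IH by blast
  show ?case
  proof (cases "p < n \<or> x < 0")
    case True
    then show ?thesis using twin.insertion[OF W R(2,3)] R(1) by blast
  next
    case False
    then have "R = R' @ [int n + 1]"
      using R signed_word_length[OF R(4)] by (simp add: insert_at_def)
    then show ?thesis using twin.augment[OF W] by blast
  qed
qed

text \<open>After removal of the largest letter \<open>\<plusminus>(n + 2)\<close>, the final ascent leaves only the cases covered
  by the two rules: a letter in the last position is positive, one in the last but one negative.\<close>

lemma twin_exists_right: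
  assumes "W \<in> signed_words (Suc n)" "1 \<in> set W"
    and "\<And>k. 1 \<le> k \<Longrightarrow> k \<le> int n + 1 \<Longrightarrow> ends_with_ascent (below k W)"
  shows "\<exists>R. twin n W R"
  using assms
proof (induction n arbitrary: W)
  case 0
  then have "length W = 1" by (simp add: signed_words_def)
  then have "W = [1]" using 0 by (auto simp: length_Suc_conv)
  then show ?case using twin.start by blast
next
  case (Suc n)
  obtain p x W' where W: "W = insert_at p x W'" "p \<le> Suc n" "\<bar>x\<bar> = int n + 2"
    "W' \<in> signed_words (Suc n)"
    using signed_words_Suc_cases[OF Suc.prems(1)] by (smt (verit) of_nat_Suc)
  have len: "length W' = Suc n" using W signed_word_length by blast
  have "ends_with_ascent (below k W')" if "1 \<le> k" "k \<le> int n + 1" for k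
    using Suc.prems(3)[of k] that W by (simp add: below_insert_at)
  moreover have "1 \<in> set W'" using Suc.prems(2) W by (auto simp: set_insert_at)
  ultimately obtain R where R: "twin n W' R" using Suc.IH W(4) by blast
  have "ends_with_ascent W"
    using Suc.prems(3)[of "int n + 2"] below_signed_word[OF Suc.prems(1), of "int n + 2"] by simp
  then have asc: "W ! n < W ! Suc n"
    using W len by (simp add: ends_with_ascent_def)
  have b: "\<bar>W' ! n\<bar> < int n + 2"
    using signed_word_bound[OF W(4), of "W' ! n"] len by simp
  show ?case
  proof (cases "p = Suc n")
    case True
    then have "x > 0" using asc W b len by (auto simp: nth_insert_at)
    then have "W = W' @ [int n + 2]" using W True len by (simp add: insert_at_def)
    then show ?thesis using twin.augment[OF R] by blast
  next
    case False
    have "p < n \<or> x < 0" using asc W b len False by (cases "p = n") (auto simp: nth_insert_at)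
    \<comment> \<open>\<open>y\<close> is the letter of the right word paired with \<open>x\<close>.\<close>
    moreover define y where "y = x - sgn x"
    moreover have "y + sgn y = x" "\<bar>y\<bar> = int n + 1" "x < 0 \<longleftrightarrow> y < 0"
      using W(3) by (auto simp: y_def sgn_if)
    ultimately show ?thesis using twin.insertion[OF R, of p y] False W by auto
  qed
qed

section \<open>From signed permutations to words\<close>

lemma length_word [simp]: "length (word n \<sigma>) = n"
  by (simp add: word_def)

lemma nth_word: "i < n \<Longrightarrow> word n \<sigma> ! i = \<sigma> (int i + 1)"
  by (simp add: word_def add.commute)

lemma word_signed_words:
  assumes "\<sigma> \<in> signed_perms n"
  shows "word n \<sigma> \<in> signed_words n"
proof -
  have p: "\<sigma> permutes pm_interval n" and odd: "\<And>i. i \<in> pm_interval n \<Longrightarrow> \<sigma> (- i) = - \<sigma> i"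
    using assms by (auto simp: signed_perms_def)
  have "abs ` \<sigma> ` {1..int n} = {1..int n}"
  proof (intro equalityI subsetI)
    fix y assume "y \<in> abs ` \<sigma> ` {1..int n}"
    then obtain i where i: "i \<in> {1..int n}" "y = \<bar>\<sigma> i\<bar>" by blast
    then have "\<sigma> i \<in> pm_interval n"
      using permutes_in_image[OF p, of i] by (simp add: pm_interval_def)
    then show "y \<in> {1..int n}" using i by (simp add: pm_interval_def)
  next
    fix y assume "y \<in> {1..int n}"
    then have "y \<in> pm_interval n" by (simp add: pm_interval_def)
    then obtain i where i: "i \<in> pm_interval n" "\<sigma> i = y"
      using permutes_image[OF p] by (metis imageE)
    then have "\<bar>\<sigma> \<bar>i\<bar>\<bar> = y" "\<bar>i\<bar> \<in> {1..int n}"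
      using odd[OF i(1)] \<open>y \<in> {1..int n}\<close> by (auto simp: pm_interval_def abs_if)
    then show "y \<in> abs ` \<sigma> ` {1..int n}" by (metis imageI)
  qed
  then show ?thesis by (simp add: signed_words_def word_def)
qed

lemma inj_on_word: "inj_on (word n) (signed_perms n)"
proof (rule inj_onI, rule ext)
  fix \<sigma> \<tau> i
  assume st: "\<sigma> \<in> signed_perms n" "\<tau> \<in> signed_perms n" and eq: "word n \<sigma> = word n \<tau>"
  have pos: "\<sigma> j = \<tau> j" if "j \<in> {1..int n}" for j
    using eq that by (simp add: word_def)
  show "\<sigma> i = \<tau> i"
  proof (cases "i \<in> pm_interval n")
    case False
    then show ?thesis using st by (simp add: signed_perms_def permutes_def)
  next
    case True
    then have "\<bar>i\<bar> \<in> {1..int n}" "- i \<in> pm_interval n" by (auto simp: pm_interval_def)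
    moreover have "\<sigma> (- i) = - \<sigma> i" "\<tau> (- i) = - \<tau> i"
      using st True by (auto simp: signed_perms_def)
    ultimately show ?thesis using pos[of "\<bar>i\<bar>"] by (auto simp: abs_if split: if_splits)
  qed
qed

text \<open>The inverse of \<open>word n\<close> extends a word to an odd function on the nonzero positions.\<close>

lemma word_surj:
  assumes w: "w \<in> signed_words n"
  shows "\<exists>\<sigma>\<in>signed_perms n. word n \<sigma> = w"
proof -
  define \<sigma> where "\<sigma> i = (if i \<in> pm_interval n then sgn i * w ! nat (\<bar>i\<bar> - 1) else i)" for i
  have len: "length w = n" using w signed_word_length by blast
  have ix: "nat (\<bar>i\<bar> - 1) < n" if "i \<in> pm_interval n" for i
    using that by (auto simp: pm_interval_def)
  have abs_\<sigma>: "\<bar>\<sigma> i\<bar> = \<bar>w ! nat (\<bar>i\<bar> - 1)\<bar>" if "i \<in> pm_interval n" for i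
    using that by (auto simp: \<sigma>_def abs_mult pm_interval_def)
  have odd: "\<sigma> (- i) = - \<sigma> i" for i by (auto simp: \<sigma>_def pm_interval_def)
  have maps: "\<sigma> i \<in> pm_interval n" if "i \<in> pm_interval n" for i
    using signed_word_bound[OF w, of "w ! nat (\<bar>i\<bar> - 1)"] ix[OF that] abs_\<sigma>[OF that] len
    by (simp add: pm_interval_def)
  have inj: "inj_on \<sigma> (pm_interval n)"
  proof (rule inj_onI)
    fix i j assume ij: "i \<in> pm_interval n" "j \<in> pm_interval n" "\<sigma> i = \<sigma> j"
    then have "\<bar>w ! nat (\<bar>i\<bar> - 1)\<bar> = \<bar>w ! nat (\<bar>j\<bar> - 1)\<bar>" using abs_\<sigma> by metis
    then have "map abs w ! nat (\<bar>i\<bar> - 1) = map abs w ! nat (\<bar>j\<bar> - 1)" using ix ij len by simp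
    then have "nat (\<bar>i\<bar> - 1) = nat (\<bar>j\<bar> - 1)"
      using nth_eq_iff_index_eq[OF signed_word_distinct[OF w]] ix ij len by (metis length_map)
    then have "\<bar>i\<bar> = \<bar>j\<bar>" using ij(1,2) unfolding pm_interval_def mem_Collect_eq by linarith
    moreover have "\<sigma> i \<noteq> 0" using maps[OF ij(1)] by (auto simp: pm_interval_def)
    ultimately show "i = j" using ij(3) odd[of i] odd[of j] by (auto simp: abs_eq_iff)
  qed
  have "finite (pm_interval n)"
    by (rule finite_subset[of _ "{- int n..int n}"]) (auto simp: pm_interval_def)
  then have "bij_betw \<sigma> (pm_interval n) (pm_interval n)"
    using inj maps by (simp add: bij_betw_def endo_inj_surj image_subset_iff)
  then have "\<sigma> permutes pm_interval n"
    by (rule bij_imp_permutes) (simp add: \<sigma>_def)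
  then have "\<sigma> \<in> signed_perms n" using odd by (simp add: signed_perms_def)
  moreover have "word n \<sigma> = w"
    using len by (intro nth_equalityI) (auto simp: nth_word \<sigma>_def pm_interval_def)
  ultimately show ?thesis by blast
qed

lemma positive_abs_minima_iff_guarded:
  assumes "\<sigma> \<in> signed_perms n"
  shows "positive_abs_minima n (int s + 1) \<sigma> \<longleftrightarrow> guarded s (word n \<sigma>)"
proof -
  let ?w = "word n \<sigma>"
  have step: "(\<bar>\<sigma> (int i + 1)\<bar> = Min ((\<lambda>j. \<bar>\<sigma> j\<bar>) ` {int s + 1..int i + 1}) \<longrightarrow> \<sigma> (int i + 1) > 0)
      \<longleftrightarrow> (?w ! i < 0 \<longrightarrow> (\<exists>j. s \<le> j \<and> j < i \<and> \<bar>?w ! j\<bar> < \<bar>?w ! i\<bar>))"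
    if i: "i < n" "s \<le> i" for i
  proof -
    have "\<bar>\<sigma> (int i + 1)\<bar> = Min ((\<lambda>j. \<bar>\<sigma> j\<bar>) ` {int s + 1..int i + 1}) \<longleftrightarrow>
        (\<forall>j\<in>{int s + 1..int i + 1}. \<bar>\<sigma> (int i + 1)\<bar> \<le> \<bar>\<sigma> j\<bar>)"
      using i by (subst eq_Min_iff) auto
    also have "\<dots> \<longleftrightarrow> (\<forall>j. s \<le> j \<and> j < i \<longrightarrow> \<bar>?w ! i\<bar> \<le> \<bar>?w ! j\<bar>)" (is "?L = ?R")
    proof
      assume ?L
      then show ?R using i by (auto simp: nth_word)
    next
      assume r: ?R
      show ?L
      proof
        fix j assume j: "j \<in> {int s + 1..int i + 1}"
        show "\<bar>\<sigma> (int i + 1)\<bar> \<le> \<bar>\<sigma> j\<bar>"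
        proof (cases "j = int i + 1")
          case False
          define l where "l = nat (j - 1)"
          have "j = int l + 1" "s \<le> l" "l < i" using j False by (auto simp: l_def)
          then show ?thesis using r i by (auto simp: nth_word)
        qed simp
      qed
    qed
    finally have min: "\<bar>\<sigma> (int i + 1)\<bar> = Min ((\<lambda>j. \<bar>\<sigma> j\<bar>) ` {int s + 1..int i + 1}) \<longleftrightarrow>
        (\<forall>j. s \<le> j \<and> j < i \<longrightarrow> \<bar>?w ! i\<bar> \<le> \<bar>?w ! j\<bar>)" .
    have "?w ! i \<noteq> 0"
      using signed_word_bound[OF word_signed_words[OF assms], of "?w ! i"] i by auto
    then have "?w ! i > 0 \<longleftrightarrow> \<not> ?w ! i < 0" by linarith
    then show ?thesis unfolding min unfolding nth_word[OF i(1), symmetric] by (meson not_le)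
  qed
  have "positive_abs_minima n (int s + 1) \<sigma> \<longleftrightarrow> (\<forall>i. s \<le> i \<and> i < n \<longrightarrow>
      (\<bar>\<sigma> (int i + 1)\<bar> = Min ((\<lambda>j. \<bar>\<sigma> j\<bar>) ` {int s + 1..int i + 1}) \<longrightarrow> \<sigma> (int i + 1) > 0))"
    (is "?L = ?R")
  proof
    assume ?L
    then show ?R by (simp add: positive_abs_minima_def)
  next
    assume r: ?R
    show ?L unfolding positive_abs_minima_def
    proof
      fix i assume i: "i \<in> {int s + 1..int n}"
      define l where "l = nat (i - 1)"
      have "i = int l + 1" "s \<le> l" "l < n" using i by (auto simp: l_def)
      then show "\<bar>\<sigma> i\<bar> = Min ((\<lambda>j. \<bar>\<sigma> j\<bar>) ` {int s + 1..i}) \<longrightarrow> 0 < \<sigma> i"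
        using r by blast
    qed
  qed
  also have "\<dots> \<longleftrightarrow> guarded s ?w"
    using step by (auto simp: guarded_def)
  finally show ?thesis .
qed

section \<open>The bijection\<close>

lemma bij_betw_of_relation:
  assumes "\<And>a. a \<in> A \<Longrightarrow> \<exists>b. T a b" "\<And>b. b \<in> B \<Longrightarrow> \<exists>a. T a b"
    and "\<And>a b. T a b \<Longrightarrow> a \<in> A \<longleftrightarrow> b \<in> B"
    and ur: "\<And>a b b'. T a b \<Longrightarrow> T a b' \<Longrightarrow> b = b'" 
    and ul: "\<And>a a' b. T a b \<Longrightarrow> T a' b \<Longrightarrow> a = a'"
  shows "bij_betw (\<lambda>a. THE b. T a b) A B"
proof -
  have the: "(THE b. T a b) = b" if "T a b" for a b
    using that ur by blast
  show ?thesis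
    unfolding bij_betw_def inj_on_def image_def
    using assms(1-3) the ul by (safe; metis)
qed

definition twin_perms :: "nat \<Rightarrow> (int \<Rightarrow> int) \<Rightarrow> (int \<Rightarrow> int) \<Rightarrow> bool" where
  "twin_perms n \<sigma> \<tau> \<longleftrightarrow> \<sigma> \<in> signed_perms (Suc n) \<and> \<tau> \<in> signed_perms n \<and>
     twin n (word (Suc n) \<sigma>) (word n \<tau>)"

text \<open>Entry \<open>1\<close> and the final ascents come for free on the left, so both memberships say that no
  restriction has a double descent.\<close>

lemma twin_perms_ADII_iff_RSII:
  assumes "twin_perms n \<sigma> \<tau>"
  shows "\<sigma> \<in> ADII (Suc n) \<longleftrightarrow> \<tau> \<in> RSII n"
proof -
  have \<sigma>: "\<sigma> \<in> signed_perms (Suc n)" and \<tau>: "\<tau> \<in> signed_perms n"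
    and t: "twin n (word (Suc n) \<sigma>) (word n \<tau>)"
    using assms by (auto simp: twin_perms_def)
  have tw: "twin k (subword (Suc n) \<sigma> (int k + 1)) (subword n \<tau> (int k))" if "k \<le> n" for k
    using twin_below[OF t that] by (simp add: subword_def)
  have one: "\<exists>i\<in>{1..int (Suc n)}. \<sigma> i = 1"
  proof -
    have "twin 0 (below 1 (word (Suc n) \<sigma>)) (below 0 (word n \<tau>))"
      using twin_below[OF t, of 0] by simp
    then have "below 1 (word (Suc n) \<sigma>) = [1]" by (cases rule: twin.cases)
    then have "1 \<in> set (below 1 (word (Suc n) \<sigma>))" by simp
    then show ?thesis by (auto simp: word_def)
  qed
  have "\<sigma> \<in> ADII (Suc n) \<longleftrightarrow>
      (\<forall>k\<in>{1..int (Suc n)}. \<not> has_double_descent (subword (Suc n) \<sigma> k) \<and>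
         ends_with_ascent (subword (Suc n) \<sigma> k))"
    using \<sigma> one by (simp add: ADII_def)
  also have "\<dots> \<longleftrightarrow> (\<forall>k\<le>n. \<not> has_double_descent (subword (Suc n) \<sigma> (int k + 1)))"
    (is "?L = ?R")
  proof
    assume ?L
    then show ?R by simp
  next
    assume r: ?R
    show ?L
    proof
      fix k assume k: "k \<in> {1..int (Suc n)}"
      define j where "j = nat (k - 1)"
      have j: "k = int j + 1" "j \<le> n" using k by (auto simp: j_def)
      show "\<not> has_double_descent (subword (Suc n) \<sigma> k) \<and> ends_with_ascent (subword (Suc n) \<sigma> k)"
        using r twin_ends_with_ascent[OF tw] j by simp
    qed
  qed
  also have "\<dots> \<longleftrightarrow> (\<forall>k\<le>n. \<not> has_double_descent (subword n \<tau> (int k)))"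
    using twin_double_descent[OF tw] by simp
  also have "\<dots> \<longleftrightarrow> (\<forall>k\<in>{1..int n}. \<not> has_double_descent (subword n \<tau> k))"
    (is "?L = ?R")
  proof
    assume l: ?L
    show ?R
    proof
      fix k assume k: "k \<in> {1..int n}"
      then have "nat k \<le> n" by simp linarith
      then show "\<not> has_double_descent (subword n \<tau> k)" using l[rule_format, of "nat k"] k by simp
    qed
  next
    assume r: ?R
    \<comment> \<open>The restriction of the left word to \<open>1\<close> is paired with the empty word on the right.\<close>
    have "subword n \<tau> 0 = []" using tw[of 0] by (auto elim: twin.cases)
    then have "\<not> has_double_descent (subword n \<tau> 0)" by (simp add: has_double_descent_def)
    then show ?L using r by (metis atLeastAtMost_iff less_one not_less of_nat_0 of_nat_1 of_nat_le_iff)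
  qed
  also have "\<dots> \<longleftrightarrow> \<tau> \<in> RSII n" using \<tau> by (simp add: RSII_def)
  finally show ?thesis .
qed

lemma ADII_twin_perm:
  assumes "\<sigma> \<in> ADII (Suc n)"
  shows "\<exists>\<tau>. twin_perms n \<sigma> \<tau>"
proof -
  have \<sigma>: "\<sigma> \<in> signed_perms (Suc n)" using assms by (simp add: ADII_def)
  have "\<exists>R. twin n (word (Suc n) \<sigma>) R"
  proof (rule twin_exists_right)
    show "word (Suc n) \<sigma> \<in> signed_words (Suc n)" using \<sigma> by (rule word_signed_words)
    show "1 \<in> set (word (Suc n) \<sigma>)" using assms by (force simp: ADII_def word_def)
    show "ends_with_ascent (below k (word (Suc n) \<sigma>))" if "1 \<le> k" "k \<le> int n + 1" for k
      using assms that by (simp add: ADII_def subword_def)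
  qed
  then obtain R where R: "twin n (word (Suc n) \<sigma>) R" by blast
  then obtain \<tau> where "\<tau> \<in> signed_perms n" "word n \<tau> = R"
    using twin_signed_words word_surj by blast
  then show ?thesis using R \<sigma> by (auto simp: twin_perms_def)
qed

lemma RSII_twin_perm:
  assumes "\<tau> \<in> RSII n"
  shows "\<exists>\<sigma>. twin_perms n \<sigma> \<tau>"
proof -
  have \<tau>: "\<tau> \<in> signed_perms n" using assms by (simp add: RSII_def)
  then obtain W where W: "twin n W (word n \<tau>)" using twin_exists_left word_signed_words by blast
  then obtain \<sigma> where "\<sigma> \<in> signed_perms (Suc n)" "word (Suc n) \<sigma> = W"
    using twin_signed_words word_surj by blast
  then show ?thesis using W \<tau> by (auto simp: twin_perms_def)
qed

lemma twin_perms_last: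
  assumes "twin_perms n \<sigma> \<tau>"
  shows "\<sigma> (int n + 1) = gae n \<tau> + 1"
proof -
  have t: "twin n (word (Suc n) \<sigma>) (word n \<tau>)" using assms by (simp add: twin_perms_def)
  have "last (word (Suc n) \<sigma>) = \<sigma> (int n + 1)"
    by (subst last_conv_nth) (auto simp: nth_word simp flip: length_0_conv)
  then show ?thesis
    using twin_last[OF t] by (simp add: gae_def augmenting_letters_def augmenting_def subword_def)
qed

lemma twin_perms_first:
  assumes "twin_perms n \<sigma> \<tau>" "n \<ge> 1"
  shows "\<sigma> 1 < 0 \<longleftrightarrow> \<tau> 1 < 0" "\<tau> 1 < 0 \<Longrightarrow> \<sigma> 1 = \<tau> 1 - 1"
proof -
  have t: "twin n (word (Suc n) \<sigma>) (word n \<tau>)" using assms by (simp add: twin_perms_def)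
  show "\<sigma> 1 < 0 \<longleftrightarrow> \<tau> 1 < 0" "\<tau> 1 < 0 \<Longrightarrow> \<sigma> 1 = \<tau> 1 - 1"
    using twin_negative_letters[OF t, of 0] assms(2) by (auto simp: nth_word)
qed

lemma twin_perms_positive_abs_minima:
  assumes "twin_perms n \<sigma> \<tau>"
  shows "positive_abs_minima (Suc n) (int s + 1) \<sigma> \<longleftrightarrow> positive_abs_minima n (int s + 1) \<tau>"
  using assms twin_guarded by (auto simp: twin_perms_def positive_abs_minima_iff_guarded)

lemma twin_perms_B_at_iff:
  assumes "twin_perms n \<sigma> \<tau>"
  shows "\<sigma> \<in> ADII_B_at (Suc n) (k + 1) \<longleftrightarrow> \<tau> \<in> RSII_B_at n k"
  using twin_perms_ADII_iff_RSII[OF assms] twin_perms_last[OF assms]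
    twin_perms_positive_abs_minima[OF assms, of 0]
  by (auto simp: ADII_B_at_def RSII_B_at_def ADII_B_def RSII_B_def add.commute)

lemma twin_perms_D_at_iff:
  assumes "twin_perms n \<sigma> \<tau>" "n \<ge> 1"
  shows "\<sigma> \<in> ADII_D_at (Suc n) (- k - 1) \<longleftrightarrow> \<tau> \<in> RSII_D_at n (- k)"
  using twin_perms_ADII_iff_RSII[OF assms(1)] twin_perms_last[OF assms(1)]
    twin_perms_positive_abs_minima[OF assms(1), of 1] twin_perms_first[OF assms]
  by (auto simp: ADII_D_at_def RSII_D_at_def ADII_D_def RSII_D_def add.commute)

theorem theorem5p5:
  fixes n :: nat
  assumes "n \<ge> 1"
  shows "\<exists>\<zeta>\<^sub>2. bij_betw \<zeta>\<^sub>2 (ADII (n + 1)) (RSII n) \<and>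
           (\<forall>k::int. 1 \<le> k \<and> k \<le> int n \<longrightarrow>
              bij_betw \<zeta>\<^sub>2 (ADII_B_at (n + 1) (k + 1)) (RSII_B_at n k) \<and>
              bij_betw \<zeta>\<^sub>2 (ADII_D_at (n + 1) (- k - 1)) (RSII_D_at n (- k)))"
proof -
  have bij: "bij_betw (\<lambda>\<sigma>. THE \<tau>. twin_perms n \<sigma> \<tau>) A B"
    if "A \<subseteq> ADII (Suc n)" "B \<subseteq> RSII n" "\<And>\<sigma> \<tau>. twin_perms n \<sigma> \<tau> \<Longrightarrow> \<sigma> \<in> A \<longleftrightarrow> \<tau> \<in> B" for A B
  proof (rule bij_betw_of_relation)
    show "\<exists>\<tau>. twin_perms n \<sigma> \<tau>" if "\<sigma> \<in> A" for \<sigma> using that \<open>A \<subseteq> _\<close> ADII_twin_perm by blast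
    show "\<exists>\<sigma>. twin_perms n \<sigma> \<tau>" if "\<tau> \<in> B" for \<tau> using that \<open>B \<subseteq> _\<close> RSII_twin_perm by blast
    show "\<tau> = \<tau>'" if "twin_perms n \<sigma> \<tau>" "twin_perms n \<sigma> \<tau>'" for \<sigma> \<tau> \<tau>'
      using that twin_unique_right inj_on_word by (metis inj_onD twin_perms_def)
    show "\<sigma> = \<sigma>'" if "twin_perms n \<sigma> \<tau>" "twin_perms n \<sigma>' \<tau>" for \<sigma> \<sigma>' \<tau>
      using that twin_unique_left inj_on_word by (metis inj_onD twin_perms_def)
  qed (rule that(3))
  have sub: "ADII_B_at (Suc n) k \<subseteq> ADII (Suc n)" "ADII_D_at (Suc n) k \<subseteq> ADII (Suc n)"
    "RSII_B_at n k \<subseteq> RSII n" "RSII_D_at n k \<subseteq> RSII n" for k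
    by (auto simp: ADII_B_at_def ADII_B_def ADII_D_at_def ADII_D_def
        RSII_B_at_def RSII_B_def RSII_D_at_def RSII_D_def)
  show ?thesis
    unfolding Suc_eq_plus1[symmetric]
  proof (intro exI[of _ "\<lambda>\<sigma>. THE \<tau>. twin_perms n \<sigma> \<tau>"] conjI allI impI)
    fix k :: int
    show "bij_betw (\<lambda>\<sigma>. THE \<tau>. twin_perms n \<sigma> \<tau>) (ADII_B_at (Suc n) (k + 1)) (RSII_B_at n k)"
      by (intro bij sub twin_perms_B_at_iff)
    show "bij_betw (\<lambda>\<sigma>. THE \<tau>. twin_perms n \<sigma> \<tau>) (ADII_D_at (Suc n) (- k - 1)) (RSII_D_at n (- k))"
      using assms by (intro bij sub twin_perms_D_at_iff)
  qed (intro bij order_refl twin_perms_ADII_iff_RSII)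
qed

end
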